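(* Let $p$ be a prime and let $q$ be a prime power for which $p \mid q-1$. Let $f: \mathbb{Z}/p \rightarrow \mathbb{F}_q$ be any nonzero function and let $m = |\mathbf{supp}\, f|$. Then the Fourier transform $\hat{f}: \mathbb{Z}/p \rightarrow \mathbb{F}_q$ of $f$ satisfies $$|\mathbf{supp}\, \hat{f}| \geq p - r_m(p),$$ where $r_m(p)$ is the size of the largest subset of $\mathbb{Z}/p$ containing no arithmetic progression of length $m$.
   Context: $\mathbb{F}_q$ denotes the finite field with $q$ elements. For a function $g: \mathbb{Z}/p \to \mathbb{F}_q$, $\mathbf{supp}\, g = \{x \in \mathbb{Z}/p : g(x) \neq 0\}$ denotes its support. Fourier transform: since $p \mid q-1$, the field $\mathbb{F}_q$ contains a primitive (principal) $p$th root of unity; fix one, $\omega \in \mathbb{F}_q$. The Fourier transform of $f: \mathbb{Z}/p \to \mathbb{F}_q$ is the function $\hat{f}: \mathbb{Z}/p \to \mathbb{F}_q$ given by $$\hat{f}(k) = p^{-1} \sum_{\ell \in \mathbb{Z}/p} \omega^{k\ell} f(\ell), \qquad k \in \mathbb{Z}/p,$$ where $p^{-1}$ is the inverse of $p$ in $\mathbb{F}_q$ (which exists because $p \mid q-1$). Arithmetic progressions: an arithmetic progression of length $m$ in $\mathbb{Z}/p$ is a subset of the form $\{a + kb \mid 0 \leq k < m\}$, with $a, b \in \mathbb{Z}/p$, that has cardinality exactly $m$. For a prime $p$ and a natural number $m$, $r_m(p)$ is the cardinality of the largest subset of $\mathbb{Z}/p$ that contains no arithmetic progression of length $m$ as a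 subset. *)

theory Defs
  imports
    "Berlekamp_Zassenhaus.Finite_Field"
    "HOL-Number_Theory.Prime_Powers"
    "HOL-Analysis.Elementary_Normed_Spaces"
begin

definition primitive_root_of_unity :: "nat \<Rightarrow> 'a::field \<Rightarrow> bool" where
  "primitive_root_of_unity n \<omega> \<longleftrightarrow> n > 0 \<and> \<omega> ^ n = 1 \<and> (\<forall>k. 0 < k \<and> k < n \<longrightarrow> \<omega> ^ k \<noteq> 1)"

abbreviation supp :: "('z \<Rightarrow> 'a::monoid_add) \<Rightarrow> 'z set" where
  "supp g \<equiv> support_on UNIV g"

text \<open>
  The exponent is an element of \<open>\<int>/p\<close>, so \<open>\<omega>\<close> is raised to its representative in
  \<open>{0..<p}\<close>; this choice is immaterial when \<open>\<omega> ^ p = 1\<close>.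
\<close>

definition fourier ::
    "'a::field \<Rightarrow> ('p::prime_card mod_ring \<Rightarrow> 'a) \<Rightarrow> 'p mod_ring \<Rightarrow> 'a" where
  "fourier \<omega> f k =
     inverse (of_nat CARD('p)) * (\<Sum>l\<in>UNIV. \<omega> ^ nat (to_int_mod_ring (k * l)) * f l)"

definition arith_prog :: "nat \<Rightarrow> 'z::comm_ring_1 set \<Rightarrow> bool" where
  "arith_prog m P \<longleftrightarrow> (\<exists>a b. P = {a + of_nat k * b | k. k < m}) \<and> card P = m"

text \<open>
  \<open>max_AP_free TYPE('p) m\<close> is \<open>r\<^sub>m(p)\<close> for \<open>p = CARD('p)\<close>.  It is meaningful for \<open>m \<ge> 1\<close>, where
  the empty set is free of progressions of length \<open>m\<close>; for \<open>m = 0\<close> the maximum is over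
  the empty set.
\<close>

definition max_AP_free :: "'p::prime_card itself \<Rightarrow> nat \<Rightarrow> nat" where
  "max_AP_free _ m =
     Max {card A | A :: 'p mod_ring set. \<not> (\<exists>P \<subseteq> A. arith_prog m P)}"

end

theory Submission
  imports Defs "HOL-Number_Theory.Residues"
begin

text \<open>
  Let \<open>S\<close> be the support of \<open>f\<close> and \<open>m = card S\<close>.  The point is that \<open>fourier \<omega> f\<close> cannot
  vanish on a progression of length \<open>m\<close>.  Write \<open>\<chi> x = \<omega> ^ x\<close> for the character of \<open>\<int>/p\<close>
  attached to \<open>\<omega>\<close>.  Up to the factor \<open>1/p\<close>, the transform at \<open>a + k b\<close> is
  \<open>\<Sum>l\<in>S. \<chi> (l a) f l * (\<chi> (l b)) ^ k\<close>, so its vanishing for \<open>k < m\<close> says that the vector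
  \<open>(\<chi> (l a) f l)\<close>, indexed by \<open>l \<in> S\<close>, is in the kernel of the \<open>m \<times> m\<close> Vandermonde matrix with
  nodes \<open>\<chi> (l b)\<close>.  For \<open>m \<ge> 2\<close> the nodes are distinct because \<open>\<omega>\<close> has order exactly \<open>p\<close>
  and \<open>b \<noteq> 0\<close>; for \<open>m = 1\<close> there is a single node.  No entry of the
  vector is \<open>0\<close>, and this contradicts \<open>vandermonde_trivial_kernel\<close>.

  Hence the zero set of the transform is free of progressions of length \<open>m\<close>
  (\<open>fourier_zeros_AP_free\<close>), and so it has at most \<open>r\<^sub>m(p)\<close> elements.
\<close>

text \<open>
  The field order is \<open>0\<close> in the field, so a multiple of \<open>p\<close> that is one less than it is \<open>-1\<close>
  there.  Thus the factor \<open>1/p\<close> in the Fourier transform is a genuine inverse: if \<open>p\<close> were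
  \<open>0\<close> in the field, \<open>fourier \<omega> f\<close> would be identically \<open>0\<close>, as \<open>inverse 0 = 0\<close>.
\<close>

lemma of_nat_neq_0_if_dvd_CARD_minus_1:
  assumes "p dvd CARD('a::finite_field) - 1"
  shows "of_nat p \<noteq> (0::'a)"
proof
  assume p: "of_nat p = (0::'a)"
  obtain j where "CARD('a) - 1 = p * j"
    using assms by (auto elim: dvdE)
  then have "CARD('a) = Suc (p * j)"
    using zero_less_card_finite[where 'a = 'a] by linarith
  then have "of_nat CARD('a) = (1::'a)"
    using p by simp
  moreover have "of_nat CARD('a) = (0::'a)"
    unfolding of_nat_eq_0_iff_char_dvd by (rule CHAR_dvd_CARD)
  ultimately show False by simp
qed

definition zp_char :: "'a::field \<Rightarrow> 'p::prime_card mod_ring \<Rightarrow> 'a" where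
  "zp_char \<omega> x = \<omega> ^ nat (to_int_mod_ring x)"

lemma power_mod_order:
  fixes \<omega> :: "'a::monoid_mult"
  assumes "\<omega> ^ n = 1"
  shows "\<omega> ^ (k mod n) = \<omega> ^ k"
  by (metis assms mult.right_neutral mult_div_mod_eq power_add power_mult power_one mult.left_neutral)

lemma zp_char_add:
  fixes x y :: "'p::prime_card mod_ring"
  assumes "\<omega> ^ CARD('p) = 1"
  shows "zp_char \<omega> (x + y) = zp_char \<omega> x * zp_char \<omega> y"
proof -
  have "0 \<le> to_int_mod_ring x" "0 \<le> to_int_mod_ring y"
    by (transfer; simp)+
  then have "nat (to_int_mod_ring (x + y))
      = (nat (to_int_mod_ring x) + nat (to_int_mod_ring y)) mod CARD('p)"
    by (simp add: to_int_mod_ring_add nat_mod_distrib nat_add_distrib)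
  then show ?thesis
    using assms by (simp add: zp_char_def power_mod_order power_add)
qed

lemma zp_char_of_nat_mult:
  fixes x :: "'p::prime_card mod_ring"
  assumes "\<omega> ^ CARD('p) = 1"
  shows "zp_char \<omega> (of_nat k * x) = zp_char \<omega> x ^ k"
proof (induction k)
  case 0
  have "to_int_mod_ring (0 :: 'p mod_ring) = 0" by transfer simp
  then show ?case by (simp add: zp_char_def)
next
  case (Suc k)
  then show ?case using assms by (simp add: zp_char_add algebra_simps)
qed

lemma zp_char_nonzero: "\<omega> \<noteq> 0 \<Longrightarrow> zp_char \<omega> x \<noteq> 0"
  by (simp add: zp_char_def)

lemma inj_zp_char:
  assumes "primitive_root_of_unity CARD('p) \<omega>"
  shows "inj (zp_char \<omega> :: 'p::prime_card mod_ring \<Rightarrow> 'a::field)"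
proof -
  have \<omega>0: "\<omega> \<noteq> 0"
    using assms by (auto simp: primitive_root_of_unity_def power_0_left split: if_splits)
  have inj: "i = j" if "i \<le> j" "j < CARD('p)" "\<omega> ^ i = \<omega> ^ j" for i j
  proof (rule ccontr)
    assume "i \<noteq> j"
    have "\<omega> ^ j = \<omega> ^ i * \<omega> ^ (j - i)"
      using that(1) by (simp flip: power_add)
    then have "\<omega> ^ (j - i) = 1"
      using that(3) \<omega>0 by simp
    then show False
      using assms that \<open>i \<noteq> j\<close> by (auto simp: primitive_root_of_unity_def)
  qed
  show ?thesis
  proof (rule injI)
    fix x y :: "'p mod_ring"
    assume eq: "zp_char \<omega> x = zp_char \<omega> y"
    have range: "0 \<le> to_int_mod_ring z \<and> to_int_mod_ring z < int CARD('p)" for z :: "'p mod_ring"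
      by transfer simp
    have less: "nat (to_int_mod_ring z) < CARD('p)" for z :: "'p mod_ring"
      using range[of z] by linarith
    have "nat (to_int_mod_ring x) = nat (to_int_mod_ring y)"
      using inj[of "nat (to_int_mod_ring x)" "nat (to_int_mod_ring y)"]
        inj[of "nat (to_int_mod_ring y)" "nat (to_int_mod_ring x)"] eq less
      by (cases "nat (to_int_mod_ring x) \<le> nat (to_int_mod_ring y)") (auto simp: zp_char_def)
    then have "to_int_mod_ring x = to_int_mod_ring y"
      using range[of x] range[of y] by linarith
    then show "x = y"
      by transfer
  qed
qed

text \<open>
  The hypothesis says that \<open>\<Sum>l\<in>S. c l * P (x l) = 0\<close> for all polynomials \<open>P\<close> of degree less
  than \<open>card S\<close>.  The polynomial with roots \<open>x t\<close> for \<open>t \<in> S - {s}\<close> isolates the term at \<open>s\<close>.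
\<close>

lemma vandermonde_trivial_kernel:
  fixes c x :: "'i \<Rightarrow> 'a::idom"
  assumes "finite S" and inj: "inj_on x S"
    and zero: "\<And>k. k < card S \<Longrightarrow> (\<Sum>l\<in>S. c l * x l ^ k) = 0"
    and "s \<in> S"
  shows "c s = 0"
proof -
  define P where "P = (\<Prod>t\<in>S - {s}. [:- x t, 1:])"
  have "degree P = card S - 1"
    using assms by (simp add: P_def degree_prod_eq_sum_degree)
  then have deg: "i < card S" if "i \<le> degree P" for i
    using that assms(1,4) card_gt_0_iff[of S] by auto
  have "(\<Sum>l\<in>S. c l * poly P (x l)) = (\<Sum>l\<in>S. \<Sum>i\<le>degree P. coeff P i * (c l * x l ^ i))"
    by (simp add: poly_altdef sum_distrib_left mult.left_commute)
  also have "\<dots> = (\<Sum>i\<le>degree P. coeff P i * (\<Sum>l\<in>S. c l * x l ^ i))"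
    by (subst sum.swap) (simp add: sum_distrib_left)
  also have "\<dots> = 0"
    using zero deg by simp
  finally have "(\<Sum>l\<in>S. c l * poly P (x l)) = 0" .
  moreover have "poly P (x l) = 0" if "l \<in> S - {s}" for l
    unfolding P_def poly_prod
    using that assms(1) by (intro prod_zero) auto
  ultimately have "c s * poly P (x s) = 0"
    using assms(1,4) by (simp add: sum.remove)
  moreover have "poly P (x s) \<noteq> 0"
    using inj assms(1,4) by (auto simp: P_def poly_prod dest: inj_onD)
  ultimately show ?thesis by simp
qed

text \<open>
  This is the heart of the argument: along a progression the transform is a linear
  combination of geometric sequences with distinct ratios and nonzero coefficients, one for
  each point of \<open>supp f\<close>, and such a combination cannot vanish at as many consecutive terms as it has summands.
\<close>

lemma fourier_zeros_AP_free:
  fixes \<omega> :: "'a::field" and f :: "'p::prime_card mod_ring \<Rightarrow> 'a"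
  assumes root: "primitive_root_of_unity CARD('p) \<omega>"
    and p_neq_0: "of_nat CARD('p) \<noteq> (0::'a)"
    and "f \<noteq> (\<lambda>_. 0)"
    and P: "arith_prog (card (supp f)) P"
  shows "\<not> P \<subseteq> - supp (fourier \<omega> f)"
proof
  assume sub: "P \<subseteq> - supp (fourier \<omega> f)"
  define m where "m = card (supp f)"
  obtain a b where P_eq: "P = (\<lambda>k. a + of_nat k * b) ` {..<m}" and card_P: "card P = m"
    using P by (auto simp: arith_prog_def m_def image_def Bex_def conj_commute)
  have \<omega>p: "\<omega> ^ CARD('p) = 1" and \<omega>0: "\<omega> \<noteq> 0"
    using root by (auto simp: primitive_root_of_unity_def power_0_left split: if_splits)
  obtain s where s: "s \<in> supp f"
    using assms(3) by (auto simp: support_on_def)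
  define x where "x l = zp_char \<omega> (l * b)" for l
  define c where "c l = zp_char \<omega> (l * a) * f l" for l
  have "c s = 0"
  proof (rule vandermonde_trivial_kernel[where S = "supp f" and x = x])
    show "inj_on x (supp f)"
      \<comment> \<open>A progression of length at most one may have \<open>b = 0\<close>; there is then at most one node.\<close>
    proof (cases "b = 0")
      case True
      have "card P \<le> card {a}"
        by (rule card_mono) (auto simp: P_eq True)
      then show ?thesis
        using card_P unfolding m_def by (auto simp: card_le_Suc0_iff_eq inj_on_def)
    next
      case False
      then show ?thesis
        by (auto simp: x_def inj_on_def dest: injD[OF inj_zp_char[OF root]])
    qed
  next
    fix k assume "k < card (supp f)"
    then have "fourier \<omega> f (a + of_nat k * b) = 0"
      using sub unfolding P_eq m_def by (auto simp: support_on_def)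
    then have "(\<Sum>l\<in>UNIV. zp_char \<omega> ((a + of_nat k * b) * l) * f l) = 0"
      using p_neq_0 by (simp add: fourier_def zp_char_def)
    moreover have "zp_char \<omega> ((a + of_nat k * b) * l) * f l = c l * x l ^ k" for l
    proof -
      have "(a + of_nat k * b) * l = l * a + of_nat k * (l * b)"
        by (simp add: algebra_simps)
      then show ?thesis
        by (simp add: c_def x_def zp_char_add[OF \<omega>p] zp_char_of_nat_mult[OF \<omega>p])
    qed
    ultimately have "(\<Sum>l\<in>UNIV. c l * x l ^ k) = 0"
      by simp
    moreover have "(\<Sum>l\<in>supp f. c l * x l ^ k) = (\<Sum>l\<in>UNIV. c l * x l ^ k)"
      by (rule sum.mono_neutral_left) (auto simp: support_on_def c_def)
    ultimately show "(\<Sum>l\<in>supp f. c l * x l ^ k) = 0" by simp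
  qed (use s in auto)
  then show False
    using s \<omega>0 by (simp add: c_def zp_char_nonzero support_on_def)
qed

lemma card_le_max_AP_free:
  fixes A :: "'p::prime_card mod_ring set"
  assumes "\<And>P. P \<subseteq> A \<Longrightarrow> \<not> arith_prog m P"
  shows "card A \<le> max_AP_free TYPE('p) m"
  unfolding max_AP_free_def
proof (rule Max_ge)
  show "finite {card A | A :: 'p mod_ring set. \<not> (\<exists>P \<subseteq> A. arith_prog m P)}"
    by (rule finite_subset[of _ "range card"]) auto
qed (use assms in auto)

theorem theorem1:
  fixes p q m :: nat
    and \<omega> :: "'a::finite_field"
    and f :: "'p::prime_card mod_ring \<Rightarrow> 'a"
  assumes "prime p" and "CARD('p) = p"
    and "primepow q" and "CARD('a) = q"
    and "p dvd q - 1"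
    and "primitive_root_of_unity p \<omega>"
    and "f \<noteq> (\<lambda>_. 0)"
    and "m = card (supp f)"
  shows "int (card (supp (fourier \<omega> f))) \<ge> int p - int (max_AP_free TYPE('p) m)"
proof -
  have p_neq_0: "of_nat CARD('p) \<noteq> (0::'a)"
    using assms of_nat_neq_0_if_dvd_CARD_minus_1 by blast
  have "card (- supp (fourier \<omega> f)) \<le> max_AP_free TYPE('p) m"
    using fourier_zeros_AP_free[OF _ p_neq_0] assms by (intro card_le_max_AP_free) blast
  moreover have "card (- supp (fourier \<omega> f)) = p - card (supp (fourier \<omega> f))"
    using assms(2) by (simp add: Compl_eq_Diff_UNIV card_Diff_subset)
  ultimately show ?thesis by linarith
qed

end
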